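(* Let $F$ be a field with $\operatorname{char}(F)\neq 2$, let $n\ge 1$ be an integer, and let $L$ be a pure nilpotent Lie algebra over $F$ with $\dim(L)=n+4$, $b(L)=2$, $\dim[L,L]=2$ and $\dim Z(L)=1$, where $Z(L)$ is the center of $L$. Then $L$ has a basis $\{x_1,x_2,x_3,z,z_1,\ldots,z_n\}$ in which the nonzero products of basis vectors (up to antisymmetry) are exactly the following: (1) if $n$ is even: $[x_1,x_2]=x_3$, $[x_1,x_3]=z$, and $[z_i,z_{i+1}]=z$ for $i=1,3,5,\ldots,n-1$; (2) if $n$ is odd: $[x_1,x_2]=x_3$, $[x_1,x_3]=z$, $[x_2,z_1]=z$, and $[z_{i+1},z_{i+2}]=z$ for $i=1,3,5,\ldots,n-2$ (this last family being empty when $n=1$).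
   Context: For a finite dimensional Lie algebra $L$ and $x\in L$, $\operatorname{ad}_x:L\to L$ denotes the map $y\mapsto [x,y]$. The breadth of $L$ is $b(L)=\max\{\operatorname{rank}(\operatorname{ad}_x)\mid x\in L\}$. A Lie algebra is called pure if it does not have a (nonzero) abelian ideal as a direct summand; equivalently, $Z(L)\subseteq [L,L]$. *)

theory Defs
  imports Complex_Main
begin

(* The underlying vector space of the Lie algebra is the whole type 'a. *)
locale lie_algebra = vector_space scale
  for scale :: "'f::field \<Rightarrow> 'a::ab_group_add \<Rightarrow> 'a"  (infixr \<open>*s\<close> 75) +
  fixes bracket :: "'a \<Rightarrow> 'a \<Rightarrow> 'a"
  assumes bracket_add_left: "bracket (x + y) z = bracket x z + bracket y z"
    and bracket_add_right: "bracket x (y + z) = bracket x y + bracket x z"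
    and bracket_scale_left: "bracket (c *s x) y = c *s bracket x y"
    and bracket_scale_right: "bracket x (c *s y) = c *s bracket x y"
    and bracket_self: "bracket x x = 0"
    and jacobi: "bracket x (bracket y z) + bracket y (bracket z x) + bracket z (bracket x y) = 0"
begin

definition ad :: "'a \<Rightarrow> 'a \<Rightarrow> 'a" where
  "ad x = (\<lambda>y. bracket x y)"

(* Meaningful only for finite-dimensional L, where the ranks are bounded by dim UNIV.
   (The dimension of an infinite-dimensional space is 0 by convention, so a positive
   value of dim UNIV already says that L is finite-dimensional.) *)
definition breadth :: nat where
  "breadth = Max {dim (range (ad x)) | x. True}"

definition commutator :: "'a set \<Rightarrow> 'a set \<Rightarrow> 'a set" where
  "commutator A B = span {bracket a b | a b. a \<in> A \<and> b \<in> B}"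

definition derived :: "'a set" where
  "derived = commutator UNIV UNIV"

definition center :: "'a set" where
  "center = {x. \<forall>y. bracket x y = 0}"

primrec lower_central :: "nat \<Rightarrow> 'a set" where
  "lower_central 0 = UNIV"
| "lower_central (Suc k) = commutator UNIV (lower_central k)"

definition nilpotent :: bool where
  "nilpotent \<longleftrightarrow> (\<exists>k. lower_central k = {0})"

definition lie_ideal :: "'a set \<Rightarrow> bool" where
  "lie_ideal I \<longleftrightarrow> subspace I \<and> (\<forall>x. \<forall>y\<in>I. bracket x y \<in> I)"

definition abelian :: "'a set \<Rightarrow> bool" where
  "abelian A \<longleftrightarrow> (\<forall>x\<in>A. \<forall>y\<in>A. bracket x y = 0)"

(* A direct summand of a Lie algebra: the complement is required to be an ideal as well. *)
definition direct_summand :: "'a set \<Rightarrow> bool" where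
  "direct_summand I \<longleftrightarrow> lie_ideal I \<and>
     (\<exists>J. lie_ideal J \<and> I \<inter> J = {0} \<and> {x + y | x y. x \<in> I \<and> y \<in> J} = UNIV)"

definition pure :: bool where
  "pure \<longleftrightarrow> \<not> (\<exists>A. direct_summand A \<and> abelian A \<and> A \<noteq> {0})"

definition basis_family :: "'i set \<Rightarrow> ('i \<Rightarrow> 'a) \<Rightarrow> bool" where
  "basis_family I e \<longleftrightarrow> inj_on e I \<and> independent (e ` I) \<and> span (e ` I) = UNIV"

(* A triple (i, j, k) in T stands for the product [e i, e j] = e k.  Every product of family
   members that is not determined by T through antisymmetry has to vanish. *)
definition nonzero_products :: "'i set \<Rightarrow> ('i \<Rightarrow> 'a) \<Rightarrow> ('i \<times> 'i \<times> 'i) set \<Rightarrow> bool" where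
  "nonzero_products I e T \<longleftrightarrow>
     (\<forall>(i, j, k)\<in>T. bracket (e i) (e j) = e k) \<and>
     (\<forall>i\<in>I. \<forall>j\<in>I. (\<forall>k. (i, j, k) \<notin> T \<and> (j, i, k) \<notin> T) \<longrightarrow> bracket (e i) (e j) = 0)"

end

(* Names for the basis x_1, x_2, x_3, z, z_1, ..., z_n. *)
datatype basis_index = X1 | X2 | X3 | Z | Zs nat

definition basis_indices :: "nat \<Rightarrow> basis_index set" where
  "basis_indices n = {X1, X2, X3, Z} \<union> Zs ` {1..n}"

end

theory Submission
  imports Defs
begin

text \<open>By nilpotency \<open>[L, [L, L]]\<close> is the center, a line spanned by some \<open>z\<close>, and modulo the
  center all brackets are multiples of any noncentral one.  A short argument with the derivation
  rule then produces \<open>x\<^sub>1\<close>, \<open>x\<^sub>2\<close> such that \<open>x\<^sub>3 = [x\<^sub>1, x\<^sub>2]\<close> and \<open>z = [x\<^sub>1, x\<^sub>3]\<close> span \<open>[L, L]\<close>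
  and \<open>[x\<^sub>2, x\<^sub>3] = 0\<close> (\<open>filiform_frame_exists\<close>).

  Let \<open>M\<close> be the common centralizer of \<open>x\<^sub>1\<close> and \<open>x\<^sub>3\<close>.  It contains \<open>z\<close> and is a complement of the
  span of \<open>x\<^sub>1, x\<^sub>2, x\<^sub>3\<close>.  The derivation rule shows that \<open>ad\<close> of \<open>x\<^sub>1\<close> kills the brackets of
  elements of \<open>M\<close> with each other and with \<open>x\<^sub>2\<close>, so these brackets are multiples of \<open>z\<close>, and
  what remains is an alternating form with values in the field.  On \<open>M\<close> this form splits into
  hyperbolic planes and a radical (\<open>hyperbolic_splitting\<close>), and subtracting from \<open>x\<^sub>2\<close> its
  projection to the planes makes it orthogonal to them.  An element of the radical that is also
  orthogonal to \<open>x\<^sub>2\<close> commutes with everything and is a multiple of \<open>z\<close>.  So the radical is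
  spanned either by \<open>z\<close> alone or by \<open>z\<close> and one further vector \<open>z\<^sub>1\<close>, normalized by
  \<open>[x\<^sub>2, z\<^sub>1] = z\<close>.  These are the two multiplication tables, the hyperbolic planes supplying
  the pairs of consecutive \<open>z\<^sub>i\<close>.

  The construction yields a spanning family for some number \<open>m\<close> in place of \<open>n\<close>.  The
  multiplication table itself forces linear independence (\<open>product_table_independent\<close>), whence
  \<open>m + 4 = dim L = n + 4\<close>; in particular the parity of \<open>n\<close> decides between the two tables.\<close>

section \<open>Splitting an alternating form into hyperbolic planes and a radical\<close>

locale alternating_form = vector_space scale
  for scale :: "'f::field \<Rightarrow> 'a::ab_group_add \<Rightarrow> 'a"  (infixr \<open>*s\<close> 75) +
  fixes form :: "'a \<Rightarrow> 'a \<Rightarrow> 'f"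
  assumes form_add_left: "form (x + y) z = form x z + form y z"
    and form_add_right: "form x (y + z) = form x y + form x z"
    and form_scale_left: "form (c *s x) y = c * form x y"
    and form_scale_right: "form x (c *s y) = c * form x y"
    and form_self: "form x x = 0"
begin

lemma form_skew: "form x y = - form y x"
proof -
  have "form (x + y) (x + y) = form x y + form y x"
    unfolding form_add_left form_add_right by (simp add: form_self)
  then show ?thesis
    by (simp add: form_self eq_neg_iff_add_eq_0 add.commute)
qed

lemma form_zero_left: "form 0 x = 0"
  using form_scale_left[of 0 0 x] by simp

lemma form_minus_left: "form (- x) y = - form x y"
  using form_scale_left[of "-1" x y] by simp

lemma form_diff_left: "form (x - y) z = form x z - form y z"
  using form_add_left[of x "- y" z] by (simp add: form_minus_left)

lemma form_diff_right: "form x (y - z) = form x y - form x z"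
  using form_diff_left[of y z x] form_skew[of x] by simp

lemma form_sum_left: "form (sum f I) x = (\<Sum>i\<in>I. form (f i) x)"
  by (induction I rule: infinite_finite_induct) (auto simp: form_zero_left form_add_left)

lemma form_span_zero:
  assumes "\<And>u. u \<in> S \<Longrightarrow> form v u = 0" and "u \<in> span S"
  shows "form v u = 0"
  using assms(2)
proof (induction rule: span_induct_alt)
  case base
  then show ?case
    using form_scale_right[of v 0 0] by simp
qed (simp add: assms(1) form_add_right form_scale_right)

definition hyperbolic :: "nat \<Rightarrow> (nat \<Rightarrow> 'a) \<Rightarrow> (nat \<Rightarrow> 'a) \<Rightarrow> bool" where
  "hyperbolic k p q \<longleftrightarrow>
     (\<forall>i<k. \<forall>j<k. form (p i) (p j) = 0 \<and> form (q i) (q j) = 0 \<and>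
        form (p i) (q j) = (if i = j then 1 else 0))"

text \<open>A hyperbolic family spans a nondegenerate subspace, so every vector has an orthogonal
  projection to that span; its coefficients are read off from the values of the form.\<close>

lemma hyperbolic_projection:
  assumes "hyperbolic k p q"
  obtains c where "c \<in> span (p ` {..<k} \<union> q ` {..<k})"
    and "\<And>i. i < k \<Longrightarrow> form (v - c) (p i) = 0"
    and "\<And>i. i < k \<Longrightarrow> form (v - c) (q i) = 0"
proof
  define c where "c = (\<Sum>i<k. form v (q i) *s p i - form v (p i) *s q i)"
  show "c \<in> span (p ` {..<k} \<union> q ` {..<k})"
    unfolding c_def by (intro span_sum span_diff span_scale span_base) auto
  fix j assume j: "j < k"
  have pp: "form (p i) (p j) = 0" "form (q i) (q j) = 0"
    and pq: "form (p i) (q j) = (if i = j then 1 else 0)"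
    and qp: "form (q i) (p j) = (if i = j then - 1 else 0)" if "i < k" for i
    using assms that j by (auto simp: hyperbolic_def form_skew[of "q i" "p j"])
  have "form c (p j) = (\<Sum>i<k. if i = j then form v (p j) else 0)"
    unfolding c_def form_sum_left form_diff_left form_scale_left
    by (intro sum.cong) (auto simp: pp qp)
  then show "form (v - c) (p j) = 0"
    using j by (simp add: form_diff_left)
  have "form c (q j) = (\<Sum>i<k. if i = j then form v (q j) else 0)"
    unfolding c_def form_sum_left form_diff_left form_scale_left
    by (intro sum.cong) (auto simp: pp pq)
  then show "form (v - c) (q j) = 0"
    using j by (simp add: form_diff_left)
qed

text \<open>Induction on the size of a generating set.  If the form does not vanish on the generators,
  two of them span a hyperbolic plane; subtracting from the other generators their projections
  to the plane leaves fewer generators, all orthogonal to the plane.\<close>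

theorem hyperbolic_splitting:
  assumes "finite A"
  obtains k p q where "p ` {..<k} \<subseteq> span A" "q ` {..<k} \<subseteq> span A" "hyperbolic k p q"
    and "\<And>w. w \<in> span A \<Longrightarrow>
      \<exists>c\<in>span (p ` {..<k} \<union> q ` {..<k}). \<forall>u\<in>span A. form (w - c) u = 0"
proof -
  have "\<exists>k p q. p ` {..<k} \<subseteq> span A \<and> q ` {..<k} \<subseteq> span A \<and> hyperbolic k p q \<and>
      (\<forall>w\<in>span A. \<exists>c\<in>span (p ` {..<k} \<union> q ` {..<k}). \<forall>u\<in>span A. form (w - c) u = 0)"
    using assms
  proof (induction "card A" arbitrary: A rule: less_induct)
    case less
    show ?case
    proof (cases "\<forall>a\<in>A. \<forall>b\<in>A. form a b = 0")
      case True
      have "form w u = 0" if "w \<in> span A" "u \<in> span A" for w u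
      proof -
        have "form a w = 0" if "a \<in> A" for a
          using True \<open>w \<in> span A\<close> that by (auto intro: form_span_zero)
        then have "form w a = 0" if "a \<in> A" for a
          using that form_skew[of w a] by simp
        then show ?thesis
          using \<open>u \<in> span A\<close> by (rule form_span_zero)
      qed
      then show ?thesis
        by (intro exI[of _ 0]) (auto simp: hyperbolic_def)
    next
      case False
      then obtain a b where ab: "a \<in> A" "b \<in> A" "form a b \<noteq> 0"
        by blast
      define b' where "b' = inverse (form a b) *s b"
      have "form a b' = 1"
        using ab by (simp add: b'_def form_scale_right)
      then have ab': "form a b' = 1" "form b' a = - 1"
        by (simp_all add: form_skew[of b' a])
      \<comment> \<open>The projection along the hyperbolic plane of \<open>a\<close> and \<open>b'\<close> to its orthogonal complement.\<close>
      define \<pi> where "\<pi> v = v - form v b' *s a + form v a *s b'" for v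
      have orth: "form (\<pi> v) a = 0" "form (\<pi> v) b' = 0" for v
        by (auto simp: \<pi>_def form_add_left form_diff_left form_scale_left form_self ab')
      define A' where "A' = \<pi> ` (A - {a, b})"
      have "a \<noteq> b"
        using ab form_self by auto
      then have "card (A - {a, b}) < card A"
        using ab less.prems by (intro psubset_card_mono) auto
      then have "card A' < card A"
        using card_image_le[of "A - {a, b}" \<pi>] less.prems by (auto simp: A'_def)
      moreover have "finite A'"
        using less.prems by (simp add: A'_def)
      ultimately obtain k p q where IH: "p ` {..<k} \<subseteq> span A'" "q ` {..<k} \<subseteq> span A'"
        "hyperbolic k p q"
        "\<forall>w\<in>span A'. \<exists>c\<in>span (p ` {..<k} \<union> q ` {..<k}). \<forall>u\<in>span A'. form (w - c) u = 0"
        using less.hyps by blast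
      have b'A: "b' \<in> span A"
        using ab by (auto simp: b'_def intro: span_scale span_base)
      have A'A: "span A' \<subseteq> span A"
      proof (rule span_minimal)
        have "\<pi> v \<in> span A" if "v \<in> A" for v
          unfolding \<pi>_def using ab b'A that
          by (intro span_add span_diff span_scale) (auto intro: span_base)
        then show "A' \<subseteq> span A"
          by (auto simp: A'_def)
      qed simp
      have orth': "form a w = 0" "form b' w = 0" if "w \<in> span A'" for w
      proof -
        have "form a u = 0 \<and> form b' u = 0" if "u \<in> A'" for u
          using orth form_skew[of a] form_skew[of b'] that by (auto simp: A'_def)
        then show "form a w = 0" "form b' w = 0"
          using \<open>w \<in> span A'\<close> by (auto intro: form_span_zero)
      qed
      have AA': "span A \<subseteq> span (insert a (insert b' A'))" (is "_ \<subseteq> span ?T")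
      proof (rule span_minimal)
        show "A \<subseteq> span ?T"
        proof
          fix v assume "v \<in> A"
          have "b = form a b *s b'"
            using ab by (simp add: b'_def)
          then have "b \<in> span ?T"
            by (metis insertCI span_base span_scale)
          moreover have "v \<in> span ?T" if "v \<notin> {a, b}"
          proof -
            have "\<pi> v \<in> ?T"
              using that \<open>v \<in> A\<close> by (auto simp: A'_def)
            then have "\<pi> v + form v b' *s a - form v a *s b' \<in> span ?T"
              by (intro span_add span_diff span_scale span_base) auto
            then show ?thesis
              by (simp add: \<pi>_def)
          qed
          ultimately show "v \<in> span ?T"
            by (cases "v \<in> {a, b}") (auto intro: span_base)
        qed
      qed simp
      let ?p = "p(k := a)" and ?q = "q(k := b')"
      have hyp: "hyperbolic (Suc k) ?p ?q"
      proof -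
        have "form a (p i) = 0" "form a (q i) = 0" "form b' (p i) = 0" "form b' (q i) = 0"
          "form (p i) a = 0" "form (q i) a = 0" "form (p i) b' = 0" "form (q i) b' = 0"
          if "i < k" for i
          using orth' IH(1,2) that form_skew[of _ a] form_skew[of _ b'] by auto
        then show ?thesis
          using IH(3) ab' by (auto simp: hyperbolic_def form_self less_Suc_eq)
      qed
      have img: "?p ` {..<Suc k} = insert a (p ` {..<k})" "?q ` {..<Suc k} = insert b' (q ` {..<k})"
        by (auto simp: lessThan_Suc)
      have split: "\<exists>c\<in>span (?p ` {..<Suc k} \<union> ?q ` {..<Suc k}). \<forall>u\<in>span A. form (w - c) u = 0"
        (is "\<exists>c\<in>span ?E. _") if "w \<in> span A" for w
      proof -
        from AA' that obtain s t where w': "w - s *s a - t *s b' \<in> span A'"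
          by (auto simp: span_insert)
        then obtain c' where c': "c' \<in> span (p ` {..<k} \<union> q ` {..<k})"
          "\<forall>u\<in>span A'. form (w - s *s a - t *s b' - c') u = 0"
          using IH(4) by blast
        define c where "c = s *s a + t *s b' + c'"
        define r where "r = w - c"
        have "span (p ` {..<k} \<union> q ` {..<k}) \<subseteq> span ?E"
          by (intro span_mono) (auto simp: img)
        then have "c \<in> span ?E"
          using c'(1) unfolding c_def
          by (intro span_add span_scale) (auto simp: img intro: span_base)
        moreover have "form r u = 0" if "u \<in> span A" for u
        proof -
          have r: "r = w - s *s a - t *s b' - c'"
            by (simp add: r_def c_def algebra_simps)
          have "span (p ` {..<k} \<union> q ` {..<k}) \<subseteq> span A'"
            using IH by (intro span_minimal) auto
          then have "r \<in> span A'"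
            using w' c'(1) unfolding r by (intro span_diff[of _ _ c']) auto
          then have "form r a = 0" "form r b' = 0"
            using orth' form_skew[of r] by auto
          moreover have "form r u = 0" if "u \<in> A'" for u
            using c'(2) that by (auto simp: r span_base)
          ultimately show ?thesis
            using that AA' by (intro form_span_zero[of "insert a (insert b' A')" r u]) auto
        qed
        ultimately show ?thesis
          by (auto simp: r_def)
      qed
      have "?p ` {..<Suc k} \<subseteq> span A" "?q ` {..<Suc k} \<subseteq> span A"
        unfolding img using IH(1,2) A'A b'A ab by (auto intro: span_base)
      with hyp split show ?thesis
        by blast
    qed
  qed
  with that show ?thesis
    by metis
qed

end

section \<open>Lie algebras with two-dimensional derived algebra and one-dimensional center\<close>

context lie_algebra
begin

lemma bracket_zero_right [simp]: "bracket x 0 = 0"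
  using bracket_scale_right[of x 0 0] by simp

lemma bracket_zero_left [simp]: "bracket 0 x = 0"
  using bracket_scale_left[of 0 0 x] by simp

lemma bracket_skew: "bracket x y = - bracket y x"
proof -
  have "bracket (x + y) (x + y) = bracket x y + bracket y x"
    unfolding bracket_add_left bracket_add_right by (simp add: bracket_self)
  then show ?thesis
    by (simp add: bracket_self eq_neg_iff_add_eq_0)
qed

lemma bracket_minus_left: "bracket (- x) y = - bracket x y"
  using bracket_scale_left[of "-1" x y] by simp

lemma bracket_minus_right: "bracket x (- y) = - bracket x y"
  using bracket_scale_right[of x "-1" y] by simp

lemma bracket_diff_left: "bracket (x - y) z = bracket x z - bracket y z"
  using bracket_add_left[of x "- y" z] by (simp add: bracket_minus_left)

lemma bracket_diff_right: "bracket x (y - z) = bracket x y - bracket x z"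
  using bracket_add_right[of x y "- z"] by (simp add: bracket_minus_right)

lemma bracket_sum_right: "bracket x (sum f I) = (\<Sum>i\<in>I. bracket x (f i))"
  by (induction I rule: infinite_finite_induct) (auto simp: bracket_add_right)

lemma bracket_derivation:
  "bracket x (bracket y z) = bracket (bracket x y) z + bracket y (bracket x z)"
  using jacobi[of x y z] bracket_skew[of z "bracket x y"] bracket_skew[of z x]
  by (simp add: bracket_minus_right algebra_simps eq_neg_iff_add_eq_0)

lemma subspace_center: "subspace center"
  by (auto simp: subspace_def center_def bracket_add_left bracket_scale_left)

lemma bracket_in_derived: "bracket x y \<in> derived"
  by (auto simp: derived_def commutator_def intro: span_base)

lemma commutator_mono: "B \<subseteq> C \<Longrightarrow> commutator A B \<subseteq> commutator A C"
  unfolding commutator_def by (intro span_mono) auto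

lemma bracket_in_commutator: "y \<in> B \<Longrightarrow> bracket x y \<in> commutator UNIV B"
  by (auto simp: commutator_def intro: span_base)

text \<open>By induction such a set stays inside every term of the lower central series.\<close>

lemma nilpotent_subset_commutator_trivial:
  assumes "nilpotent" and "I \<subseteq> commutator UNIV I"
  shows "I \<subseteq> {0}"
proof -
  have "I \<subseteq> lower_central k" for k
  proof (induction k)
    case (Suc k)
    show ?case
      using assms(2) commutator_mono[OF Suc] by auto
  qed simp
  then show ?thesis
    using assms(1) by (auto simp: nilpotent_def)
qed

text \<open>By nilpotency the ideals \<open>[L, L]\<close>, \<open>[L, [L, L]]\<close>, \<open>[L, [L, [L, L]]]\<close> strictly decrease
  until they vanish.  Since \<open>[L, L]\<close> is too large to be central, their dimensions are
  \<open>2\<close>, \<open>1\<close>, \<open>0\<close>, and the second of them fills the center.\<close>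

lemma derived_center_structure:
  assumes nil: nilpotent and fin: "dim UNIV > 0"
    and der: "dim derived = 2" and cen: "dim center = 1"
  shows bracket_derived_in_center: "d \<in> derived \<Longrightarrow> bracket x d \<in> center"
    and center_eq_span: "z \<in> center \<Longrightarrow> z \<noteq> 0 \<Longrightarrow> center = span {z}"
    and derived_mod_center: "w \<in> derived \<Longrightarrow> w \<notin> center \<Longrightarrow> d \<in> derived \<Longrightarrow> \<exists>b. d - b *s w \<in> center"
    and noncentral_bracket: "\<exists>u v. bracket u v \<notin> center"
proof -
  obtain Bs where Bs: "independent Bs" "span Bs = UNIV" "card Bs = dim UNIV"
    using basis_exists[of UNIV] by (metis top.extremum_uniqueI)
  interpret finite_dimensional_vector_space scale Bs
    using Bs fin by unfold_locales (auto intro: card_ge_0_finite)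
  define D where "D = commutator UNIV derived"
  have subs: "subspace derived" "subspace D" "subspace (commutator UNIV D)"
    by (simp_all add: derived_def D_def commutator_def)
  have D_sub: "D \<subseteq> derived"
    using commutator_mono[of derived UNIV UNIV] by (simp add: D_def derived_def)
  have "\<not> derived \<subseteq> D"
    using nilpotent_subset_commutator_trivial[OF nil, of derived] der dim_eq_0[of derived]
    by (auto simp: D_def simp del: dim_eq_0)
  then have "dim D \<le> 1"
    using subspace_dim_equal[OF subs(2,1) D_sub] der by force
  have "\<not> derived \<subseteq> center"
    using dim_subset[of derived center] der cen by auto
  then show "\<exists>u v. bracket u v \<notin> center"
    using span_minimal[of "{bracket a b |a b. a \<in> UNIV \<and> b \<in> UNIV}" center] subspace_center
    unfolding derived_def commutator_def by blast
  have D_central: "D \<subseteq> center"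
  proof -
    have sub: "commutator UNIV D \<subseteq> D"
      using commutator_mono[OF D_sub] by (simp add: D_def)
    have "commutator UNIV D \<subseteq> {0}"
    proof (rule ccontr)
      assume nonzero: "\<not> ?thesis"
      then have "dim (commutator UNIV D) \<ge> dim D"
        using \<open>dim D \<le> 1\<close> dim_eq_0[of "commutator UNIV D"] by linarith
      then have "commutator UNIV D = D"
        using subspace_dim_equal[OF subs(3,2) sub] by simp
      then show False
        using nonzero nilpotent_subset_commutator_trivial[OF nil, of D] by simp
    qed
    then have "bracket x d = 0" if "d \<in> D" for x d
      using bracket_in_commutator[OF that, of x] by auto
    then have "bracket d x = 0" if "d \<in> D" for x d
      using that bracket_skew[of d x] by simp
    then show ?thesis
      by (auto simp: center_def)
  qed
  then show "d \<in> derived \<Longrightarrow> bracket x d \<in> center"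
    using bracket_in_commutator[of d derived x] by (auto simp: D_def)
  have center_le: "center \<subseteq> derived"
  proof -
    obtain d where "d \<in> derived" "d \<notin> center"
      using \<open>\<not> derived \<subseteq> center\<close> by blast
    then obtain x where "bracket x d \<noteq> 0"
      using bracket_skew[of d] by (auto simp: center_def)
    then have "dim D \<noteq> 0"
      using bracket_in_commutator[OF \<open>d \<in> derived\<close>, of x] by (auto simp: D_def)
    then have "dim D \<ge> dim center"
      using cen by linarith
    then have "D = center"
      by (rule subspace_dim_equal[OF subs(2) subspace_center D_central])
    then show ?thesis
      using D_sub by simp
  qed
  show ceq: "center = span {z}" if "z \<in> center" "z \<noteq> 0" for z
    using subspace_dim_equal[of "span {z}" center] span_minimal[of "{z}" center] that cen
      subspace_center by auto
  show "\<exists>b. d - b *s w \<in> center" if w: "w \<in> derived" "w \<notin> center" and d: "d \<in> derived"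
  proof -
    have "\<not> center \<subseteq> {0}"
      using cen dim_eq_0[of center] by auto
    then obtain z where z: "z \<in> center" "z \<noteq> 0"
      by blast
    then have "w \<notin> span {z}"
      using ceq w by simp
    then have "dim (span {w, z}) = 2"
      using z by (simp add: dim_insert)
    moreover have "span {w, z} \<subseteq> derived"
      using w z center_le subs(1) by (intro span_minimal) auto
    ultimately have "span {w, z} = derived"
      using subspace_dim_equal[OF _ subs(1)] der by simp
    then have "d \<in> span (insert w {z})"
      using d by simp
    then show ?thesis
      using ceq[OF z] by (auto simp: span_insert)
  qed
qed

text \<open>Start from a noncentral bracket \<open>w = [u, v]\<close> and \<open>x\<close> with \<open>[x, w] \<noteq> 0\<close>.  As \<open>ad\<^sub>x\<close> is a
  derivation, \<open>[x, u]\<close> and \<open>[x, v]\<close> cannot both be central; a noncentral one of them is a nonzero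
  multiple of \<open>w\<close> modulo the center, hence not annihilated by \<open>ad\<^sub>x\<close>.  This produces
  \<open>[x, [x, t]] \<noteq> 0\<close>, and subtracting a multiple of \<open>x\<close> from \<open>t\<close> makes it commute with \<open>[x, t]\<close>.\<close>

lemma filiform_frame_exists:
  assumes nil: nilpotent and fin: "dim UNIV > 0"
    and der: "dim derived = 2" and cen: "dim center = 1"
  obtains x1 x2 x3 z where "bracket x1 x2 = x3" "bracket x1 x3 = z" "bracket x2 x3 = 0"
    "z \<noteq> 0" "center = span {z}"
    "\<And>u v. \<exists>b c. bracket u v = b *s x3 + c *s z"
proof -
  note hyps = nil fin der cen
  obtain u v where w: "bracket u v \<notin> center"
    using noncentral_bracket[OF hyps] by blast
  define w where "w = bracket u v"
  obtain x where x: "bracket x w \<noteq> 0"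
    using w bracket_skew[of w] by (auto simp: center_def w_def)
  have "bracket x u \<notin> center \<or> bracket x v \<notin> center"
  proof (rule ccontr)
    assume "\<not> ?thesis"
    then have "bracket (bracket x u) v = 0" "bracket u (bracket x v) = 0"
      using bracket_skew[of u "bracket x v"] by (auto simp: center_def)
    then show False
      using x bracket_derivation[of x u v] by (simp add: w_def)
  qed
  then obtain t where t: "bracket x t \<notin> center"
    by blast
  define x3 where "x3 = bracket x t"
  define z where "z = bracket x x3"
  have x3: "x3 \<in> derived" "x3 \<notin> center"
    using t by (auto simp: x3_def bracket_in_derived)
  obtain b where b: "x3 - b *s w \<in> center"
    using derived_mod_center[OF hyps _ _ x3(1), of w] w by (auto simp: w_def bracket_in_derived)
  then have "bracket x (x3 - b *s w) = 0"
    using bracket_skew[of x "x3 - b *s w"] by (simp add: center_def)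
  then have z_eq: "z = b *s bracket x w"
    by (simp add: z_def bracket_diff_right bracket_scale_right)
  have "b \<noteq> 0"
    using b x3(2) by auto
  then have "z \<noteq> 0"
    using x z_eq by simp
  have "z \<in> center"
    unfolding z_def by (rule bracket_derived_in_center[OF hyps x3(1)])
  then have c: "center = span {z}"
    using center_eq_span[OF hyps] \<open>z \<noteq> 0\<close> by simp
  have "bracket t x3 \<in> center"
    by (rule bracket_derived_in_center[OF hyps x3(1)])
  then obtain s where s: "bracket t x3 = s *s z"
    using c by (auto simp: span_singleton)
  define x2 where "x2 = t - s *s x"
  show thesis
  proof
    show "bracket x x2 = x3"
      by (simp add: x2_def bracket_diff_right bracket_scale_right bracket_self x3_def)
    show "bracket x x3 = z"
      by (simp add: z_def)
    show "bracket x2 x3 = 0"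
      by (simp add: x2_def bracket_diff_left bracket_scale_left s z_def)
    show "\<exists>b c. bracket u v = b *s x3 + c *s z" for u v
    proof -
      obtain b where "bracket u v - b *s x3 \<in> center"
        using derived_mod_center[OF hyps x3 bracket_in_derived] by blast
      then obtain c where "bracket u v - b *s x3 = c *s z"
        using c by (auto simp: span_singleton)
      then have "bracket u v = b *s x3 + c *s z"
        by (simp add: algebra_simps)
      then show ?thesis by blast
    qed
  qed (use \<open>z \<noteq> 0\<close> c in auto)
qed

end

section \<open>The multiplication tables determine bases\<close>

definition product_table :: "nat \<Rightarrow> (basis_index \<times> basis_index \<times> basis_index) set" where
  "product_table n =
     (if even n
      then {(X1, X2, X3), (X1, X3, Z)} \<union> {(Zs i, Zs (i + 1), Z) | i. odd i \<and> i + 1 \<le> n}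
      else {(X1, X2, X3), (X1, X3, Z), (X2, Zs 1, Z)} \<union>
        {(Zs (i + 1), Zs (i + 2), Z) | i. odd i \<and> i + 2 \<le> n})"

lemma product_table_even:
  assumes "even n"
  shows "(i, j, k) \<in> product_table n \<longleftrightarrow>
    i = X1 \<and> j = X2 \<and> k = X3 \<or> i = X1 \<and> j = X3 \<and> k = Z \<or>
    (\<exists>a. i = Zs a \<and> j = Zs (a + 1) \<and> k = Z \<and> odd a \<and> a + 1 \<le> n)"
  using assms by (auto simp: product_table_def)

text \<open>Indexed by the first member of each pair, as in the even table.\<close>

lemma product_table_odd:
  assumes "odd n"
  shows "(i, j, k) \<in> product_table n \<longleftrightarrow>
    i = X1 \<and> j = X2 \<and> k = X3 \<or> i = X1 \<and> j = X3 \<and> k = Z \<or> i = X2 \<and> j = Zs 1 \<and> k = Z \<or>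
    (\<exists>a. i = Zs a \<and> j = Zs (a + 1) \<and> k = Z \<and> even a \<and> 2 \<le> a \<and> a + 1 \<le> n)"
proof -
  have "(\<exists>b. i = Zs (b + 1) \<and> j = Zs (b + 2) \<and> odd b \<and> b + 2 \<le> n) \<longleftrightarrow>
    (\<exists>a. i = Zs a \<and> j = Zs (a + 1) \<and> even a \<and> 2 \<le> a \<and> a + 1 \<le> n)" (is "?l \<longleftrightarrow> ?r")
  proof
    assume ?l
    then obtain b where "i = Zs (b + 1)" "j = Zs (b + 2)" "odd b" "b + 2 \<le> n"
      by blast
    then show ?r
      by (intro exI[of _ "b + 1"]) (auto elim: oddE)
  next
    assume ?r
    then obtain a where "i = Zs a" "j = Zs (a + 1)" "even a" "2 \<le> a" "a + 1 \<le> n"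
      by blast
    then show ?l
      by (intro exI[of _ "a - 1"]) auto
  qed
  then show ?thesis
    using assms by (auto simp: product_table_def)
qed

lemma finite_basis_indices: "finite (basis_indices n)"
  by (simp add: basis_indices_def)

lemma card_basis_indices: "card (basis_indices n) = n + 4"
proof -
  have "card (Zs ` {1..n}) = n"
    by (simp add: card_image inj_on_def)
  moreover have "{X1, X2, X3, Z} \<inter> Zs ` {1..n} = {}"
    by auto
  ultimately show ?thesis
    unfolding basis_indices_def by (subst card_Un_disjoint) auto
qed

lemma (in vector_space) inj_independent_if_relations_trivial:
  assumes fin: "finite I"
    and triv: "\<And>c i. (\<Sum>i\<in>I. c i *s e i) = 0 \<Longrightarrow> i \<in> I \<Longrightarrow> c i = 0"
  shows "inj_on e I" and "independent (e ` I)"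
proof -
  show inj: "inj_on e I"
  proof (rule inj_onI, rule ccontr)
    fix i j assume ij: "i \<in> I" "j \<in> I" "e i = e j" "i \<noteq> j"
    define c where "c l = (if l = i then 1 else 0) - (if l = j then 1 else (0 :: 'a))" for l
    have "(\<Sum>l\<in>I. c l *s e l) = (\<Sum>l\<in>I. (if l = i then e i else 0) - (if l = j then e j else 0))"
      by (intro sum.cong) (auto simp: c_def)
    also have "\<dots> = 0"
      using ij fin by (simp add: sum_subtractf)
    finally show False
      using triv[of c i] ij by (simp add: c_def)
  qed
  show "independent (e ` I)"
  proof
    assume "dependent (e ` I)"
    then obtain u where u: "\<exists>v\<in>e ` I. u v \<noteq> 0" "(\<Sum>v\<in>e ` I. u v *s v) = 0"
      using fin by (auto simp: dependent_finite)
    then have "(\<Sum>i\<in>I. u (e i) *s e i) = 0"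
      by (simp add: sum.reindex[OF inj])
    then show False
      using u(1) triv[of "\<lambda>i. u (e i)"] by auto
  qed
qed

context lie_algebra
begin

text \<open>Applying \<open>ad\<^sub>a\<close> to a linear relation isolates the coefficient of the one vector
  that \<open>a\<close> does not annihilate, among those whose coefficient is not already known to vanish.\<close>

lemma coefficient_zero:
  assumes "(\<Sum>i\<in>I. c i *s v i) = 0" and "finite I" "j \<in> I"
    and "\<And>i. i \<in> I \<Longrightarrow> i \<noteq> j \<Longrightarrow> c i = 0 \<or> bracket a (v i) = 0"
    and "bracket a (v j) \<noteq> 0"
  shows "c j = 0"
proof -
  have "0 = (\<Sum>i\<in>I. bracket a (c i *s v i))"
    using assms(1) bracket_sum_right[of a "\<lambda>i. c i *s v i" I] by simp
  also have "\<dots> = (\<Sum>i\<in>I. if i = j then c j *s bracket a (v j) else 0)"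
    using assms(4) by (intro sum.cong) (auto simp: bracket_scale_right)
  also have "\<dots> = c j *s bracket a (v j)"
    using assms(2,3) by simp
  finally show ?thesis
    using assms(5) by simp
qed

text \<open>In a family with these products every member other than \<open>z\<close> is carried to a nonzero
  multiple of \<open>z\<close> by at most two bracketings that annihilate the other members, up to members
  whose coefficients are already known to vanish.  So linear independence is a
  consequence of the multiplication table.\<close>

lemma product_table_independent:
  assumes table: "nonzero_products (basis_indices n) e (product_table n)" and z: "e Z \<noteq> 0"
  shows "inj_on e (basis_indices n)" and "independent (e ` basis_indices n)"
proof -
  let ?I = "basis_indices n"
  have prod: "bracket (e i) (e j) = e k" if "(i, j, k) \<in> product_table n" for i j k
    using table that by (auto simp: nonzero_products_def)
  have prod': "bracket (e j) (e i) = - e k" if "(i, j, k) \<in> product_table n" for i j k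
    by (subst bracket_skew) (simp add: prod[OF that])
  have zero: "bracket (e i) (e j) = 0"
    if "i \<in> ?I" "j \<in> ?I" "\<forall>k. (i, j, k) \<notin> product_table n \<and> (j, i, k) \<notin> product_table n" for i j
    using table that by (auto simp: nonzero_products_def)
  have I: "X1 \<in> ?I" "X2 \<in> ?I" "X3 \<in> ?I" "Z \<in> ?I" "Zs a \<in> ?I \<longleftrightarrow> 1 \<le> a \<and> a \<le> n" for a
    by (auto simp: basis_indices_def)
  note fin = finite_basis_indices[of n]
  have triv: "c i = 0" if rel: "(\<Sum>i\<in>?I. c i *s e i) = 0" and i: "i \<in> ?I" for c i
  proof -
    have x12: "bracket (e X1) (e X2) = e X3" and x13: "bracket (e X1) (e X3) = e Z"
      by (rule prod; simp add: product_table_def)+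
    have x31: "bracket (e X3) (e X1) = - e Z"
      by (subst bracket_skew) (simp add: x13)
    have c1: "c X1 = 0"
    proof (rule coefficient_zero[OF rel fin I(1), of "e X3"])
      show "c i = 0 \<or> bracket (e X3) (e i) = 0" if "i \<in> ?I" "i \<noteq> X1" for i
        using zero[OF I(3) that(1)] that
        by (cases "even n") (auto simp: product_table_even product_table_odd)
    qed (simp add: x31 z)
    have c2s: "c X2 = 0 \<and> (\<forall>a. 1 \<le> a \<and> a \<le> n \<longrightarrow> c (Zs a) = 0)"
    proof (cases "even n")
      case True
      note T = product_table_even[OF True]
      have "c (Zs a) = 0" if a: "1 \<le> a" "a \<le> n" for a
      proof -
        \<comment> \<open>The other member of the pair of \<open>Zs a\<close>; it annihilates the rest of the family.\<close>
        define b where "b = (if odd a then a + 1 else a - 1)"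
        have "n \<noteq> a" if "odd a"
          using that True by auto
        then have b: "Zs b \<in> ?I"
          using a by (auto simp: I b_def elim: evenE)
        show ?thesis
        proof (rule coefficient_zero[OF rel fin, of _ "e (Zs b)"])
          show "Zs a \<in> ?I"
            using a by (simp add: I)
          show "c i = 0 \<or> bracket (e (Zs b)) (e i) = 0" if "i \<in> ?I" "i \<noteq> Zs a" for i
            using that a
            by (intro disjI2 zero[OF b that(1)]) (cases a; auto simp: T b_def split: if_splits)
          show "bracket (e (Zs b)) (e (Zs a)) \<noteq> 0"
          proof (cases "odd a")
            case True
            then show ?thesis
              using prod'[of "Zs a" "Zs b" Z] z b by (simp add: T b_def I)
          next
            case False
            then show ?thesis
              using prod[of "Zs b" "Zs a" Z] z b a by (auto simp: T b_def I)
          qed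
        qed
      qed
      moreover have "c X2 = 0"
      proof -
        \<comment> \<open>Bracket twice with the first vector: the second one is the only one that survives.\<close>
        have "(\<Sum>i\<in>?I. c i *s bracket (e X1) (e i)) = 0"
          using rel bracket_sum_right[of "e X1" "\<lambda>i. c i *s e i" ?I]
          by (simp add: bracket_scale_right)
        then show ?thesis
        proof (rule coefficient_zero[OF _ fin I(2), of _ _ "e X1"])
          show "c i = 0 \<or> bracket (e X1) (bracket (e X1) (e i)) = 0"
            if "i \<in> ?I" "i \<noteq> X2" for i
          proof (cases "i = X3")
            case True
            then show ?thesis
              using zero[OF I(1,4)] by (simp add: x13 T)
          next
            case False
            then show ?thesis
              using zero[OF I(1) that(1)] that by (cases "i = X1") (auto simp: T bracket_self)
          qed
        qed (simp add: x12 x13 z)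
      qed
      ultimately show ?thesis
        by blast
    next
      case False
      note T = product_table_odd[OF False]
      have n: "1 \<le> n"
        using False by (cases n) auto
      have x2z: "bracket (e X2) (e (Zs 1)) = e Z" "bracket (e (Zs 1)) (e X2) = - e Z"
        using prod[of X2 "Zs 1" Z] prod'[of X2 "Zs 1" Z] by (simp_all add: T)
      have c2: "c X2 = 0"
      proof (rule coefficient_zero[OF rel fin I(2), of "e (Zs 1)"])
        show "c i = 0 \<or> bracket (e (Zs 1)) (e i) = 0" if "i \<in> ?I" "i \<noteq> X2" for i
          using zero[of "Zs 1" i] that n by (auto simp: T I)
      qed (simp add: x2z z del: One_nat_def)
      have "c (Zs a) = 0" if a: "1 \<le> a" "a \<le> n" for a
      proof (cases "a = 1")
        case True
        have "c (Zs 1) = 0"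
        proof (rule coefficient_zero[OF rel fin, of _ "e X2"])
          show "c i = 0 \<or> bracket (e X2) (e i) = 0" if "i \<in> ?I" "i \<noteq> Zs 1" for i
            using zero[OF I(2) that(1)] that c1 by (cases "i = X1") (auto simp: T)
        qed (use x2z z n in \<open>auto simp: I\<close>)
        then show ?thesis
          using True by simp
      next
        case neq: False
        define b where "b = (if even a then a + 1 else a - 1)"
        have "n \<noteq> a" if "even a"
          using that False by auto
        then have b: "Zs b \<in> ?I"
          using a neq by (auto simp: I b_def)
        show ?thesis
        proof (rule coefficient_zero[OF rel fin, of _ "e (Zs b)"])
          show "Zs a \<in> ?I"
            using a by (simp add: I)
          show "c i = 0 \<or> bracket (e (Zs b)) (e i) = 0" if "i \<in> ?I" "i \<noteq> Zs a" for i
            using that a neq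
            by (intro disjI2 zero[OF b that(1)]) (cases a; auto simp: T b_def split: if_splits)
          show "bracket (e (Zs b)) (e (Zs a)) \<noteq> 0"
          proof (cases "even a")
            case True
            then show ?thesis
              using prod'[of "Zs a" "Zs b" Z] z b a by (auto simp: T b_def I elim: evenE)
          next
            case False
            then show ?thesis
              using prod[of "Zs b" "Zs a" Z] z b a neq by (auto simp: T b_def I elim: oddE)
          qed
        qed
      qed
      with c2 show ?thesis
        by blast
    qed
    have c3: "c X3 = 0"
    proof (rule coefficient_zero[OF rel fin I(3), of "e X1"])
      show "c i = 0 \<or> bracket (e X1) (e i) = 0" if "i \<in> ?I" "i \<noteq> X3" for i
        using c1 c2s that zero[OF I(1,4)]
        by (cases "even n") (auto simp: basis_indices_def product_table_even product_table_odd)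
    qed (simp add: x13 z)
    have others: "c i = 0" if "i \<in> ?I" "i \<noteq> Z" for i
      using that c1 c2s c3 by (auto simp: basis_indices_def)
    have "(\<Sum>i\<in>?I. c i *s e i) = (\<Sum>i\<in>?I. if i = Z then c Z *s e Z else 0)"
      using others by (intro sum.cong) auto
    then have "c Z = 0"
      using rel fin I(4) z by simp
    with others i show ?thesis
      by blast
  qed
  show "inj_on e ?I" and "independent (e ` ?I)"
    using inj_independent_if_relations_trivial[of ?I e, OF fin] triv by blast+
qed

end

section \<open>The form on the centralizer of a filiform frame\<close>

text \<open>The four vectors span a copy of the four-dimensional filiform Lie algebra that contains
  the whole derived algebra.\<close>

locale filiform_frame = lie_algebra scale bracket
  for scale :: "'f::field \<Rightarrow> 'a::ab_group_add \<Rightarrow> 'a"  (infixr \<open>*s\<close> 75) and bracket +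
  fixes x1 x2 x3 z :: 'a
  assumes bracket_12: "bracket x1 x2 = x3"
    and bracket_13: "bracket x1 x3 = z"
    and bracket_23: "bracket x2 x3 = 0"
    and z_nonzero: "z \<noteq> 0"
    and center_span: "center = span {z}"
    and bracket_span: "\<exists>b c. bracket u v = b *s x3 + c *s z"
begin

definition centralizer13 :: "'a set" where
  "centralizer13 = {y. bracket x1 y = 0 \<and> bracket x3 y = 0}"

text \<open>The intended value is \<open>c\<close> when \<open>[u, v] = c z\<close>.  Reading it off in a basis of the whole space
  keeps the form bilinear everywhere; for other brackets the value depends on the basis chosen.\<close>

definition form :: "'a \<Rightarrow> 'a \<Rightarrow> 'f" where
  "form u v = representation (extend_basis {z}) (bracket u v) z"

sublocale \<omega>: alternating_form scale form
proof -
  have "independent {z}"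
    using z_nonzero by simp
  then have "independent (extend_basis {z})" "span (extend_basis {z}) = UNIV"
    by (simp_all add: independent_extend_basis)
  then show "alternating_form scale form"
    by unfold_locales
      (simp_all add: form_def bracket_add_left bracket_add_right bracket_scale_left
        bracket_scale_right bracket_self representation_add representation_scale
        representation_zero)
qed

lemma bracket_z [simp]: "bracket z v = 0" "bracket v z = 0"
proof -
  have "z \<in> center"
    by (simp add: center_span span_base)
  then show "bracket z v = 0"
    by (simp add: center_def)
  then show "bracket v z = 0"
    by (simp add: bracket_skew[of v z])
qed

lemma bracket_eq_form:
  assumes "bracket u v \<in> span {z}"
  shows "bracket u v = form u v *s z"
proof -
  have ind: "independent {z}"
    using z_nonzero by simp
  obtain c where c: "bracket u v = c *s z"
    using assms by (auto simp: span_singleton)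
  have "z \<in> extend_basis {z}"
    using extend_basis_superset[OF ind] by simp
  then have "form u v = c"
    using independent_extend_basis[OF ind]
    by (simp add: form_def c representation_scale representation_basis span_base)
  then show ?thesis
    by (simp add: c)
qed

text \<open>Every bracket has the form \<open>b x\<^sub>3 + c z\<close>, and \<open>ad\<close> of \<open>x\<^sub>1\<close> sends it to \<open>b z\<close>.\<close>

lemma in_span_z_iff: "bracket u v \<in> span {z} \<longleftrightarrow> bracket x1 (bracket u v) = 0"
proof -
  obtain b c where bc: "bracket u v = b *s x3 + c *s z"
    using bracket_span by blast
  then have "bracket x1 (bracket u v) = b *s z"
    by (simp add: bracket_add_right bracket_scale_right bracket_13)
  moreover have "b = 0" if "b *s z = 0"
    using that z_nonzero by simp
  moreover have "bracket x1 (bracket u v) = 0" if "bracket u v \<in> span {z}"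
    using that by (auto simp: span_singleton bracket_scale_right)
  ultimately show ?thesis
    using bc by (auto simp: span_singleton)
qed

lemma subspace_centralizer13: "subspace centralizer13"
  by (auto simp: subspace_def centralizer13_def bracket_add_right bracket_scale_right)

lemma bracket_centralizer13:
  assumes "u \<in> centralizer13"
  shows "bracket x1 u = 0" "bracket u x1 = 0" "bracket x3 u = 0" "bracket u x3 = 0"
  using assms bracket_skew[of u x1] bracket_skew[of u x3] by (auto simp: centralizer13_def)

text \<open>By the derivation rule \<open>ad\<close> of \<open>x\<^sub>1\<close> annihilates these brackets: \<open>v\<close> commutes with \<open>x\<^sub>1\<close>, and
  \<open>x\<^sub>1\<close> carries \<open>x\<^sub>2\<close> to \<open>x\<^sub>3\<close>, with which \<open>v\<close> commutes as well.\<close>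

lemma bracket_eq_form_centralizer13:
  assumes "v \<in> centralizer13"
  shows "u \<in> centralizer13 \<Longrightarrow> bracket u v = form u v *s z"
    and "bracket x2 v = form x2 v *s z"
  using assms bracket_derivation[of x1 u v] bracket_derivation[of x1 x2 v]
  by (auto intro!: bracket_eq_form simp: in_span_z_iff bracket_centralizer13 bracket_12)

text \<open>The bracket of \<open>x\<^sub>1\<close> with \<open>v\<close> determines the coefficients of \<open>x\<^sub>2\<close> and \<open>x\<^sub>3\<close>, and the
  central element \<open>[x\<^sub>3, v]\<close> that of \<open>x\<^sub>1\<close>.\<close>

lemma frame_decomposition:
  obtains a b c where "v - a *s x1 - b *s x2 - c *s x3 \<in> centralizer13"
proof -
  obtain b c where bc: "bracket x1 v = b *s x3 + c *s z"
    using bracket_span by blast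
  have "bracket x1 (bracket x3 v) = 0"
    using bracket_derivation[of x1 x3 v] bracket_skew[of "bracket x1 x3" v] bc
      bracket_13 bracket_self by (simp add: bracket_add_right bracket_scale_right)
  then have "bracket x3 v \<in> span {z}"
    by (simp add: in_span_z_iff)
  then obtain a where a: "bracket x3 v = a *s z"
    by (auto simp: span_singleton)
  have "bracket x3 x1 = - z" "bracket x3 x2 = 0"
    using bracket_skew[of x3 x1] bracket_skew[of x3 x2] by (simp_all add: bracket_13 bracket_23)
  then have "v - (- a) *s x1 - b *s x2 - c *s x3 \<in> centralizer13"
    using a bc by (simp add: centralizer13_def bracket_diff_right bracket_add_right bracket_minus_right
        bracket_scale_right bracket_self bracket_12 bracket_13)
  with that show thesis
    by blast
qed

text \<open>This freedom in the choice of \<open>x\<^sub>2\<close> serves to make it orthogonal to the hyperbolic planes.\<close>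

lemma frame_shift:
  assumes "c \<in> centralizer13"
  shows "filiform_frame scale bracket x1 (x2 - c) x3 z"
  using assms bracket_12 bracket_13 bracket_23 z_nonzero center_span bracket_span
  by unfold_locales (simp_all add: bracket_diff_left bracket_diff_right bracket_centralizer13)

text \<open>As a member of the centralizer \<open>r\<close> commutes with \<open>x\<^sub>1\<close> and \<open>x\<^sub>3\<close>; vanishing of the form makes it
  commute with \<open>x\<^sub>2\<close> and with the centralizer.  Together these span the whole algebra.\<close>

lemma radical_in_center:
  assumes r: "r \<in> centralizer13" and rad: "\<And>u. u \<in> centralizer13 \<Longrightarrow> form r u = 0"
    and "form x2 r = 0"
  shows "r \<in> span {z}"
proof -
  have "bracket r v = 0" for v
  proof -
    obtain a b c where m: "v - a *s x1 - b *s x2 - c *s x3 \<in> centralizer13"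
      using frame_decomposition by blast
    have "bracket r x2 = 0"
      using bracket_eq_form_centralizer13(2)[OF r] assms(3) bracket_skew[of r x2] by simp
    moreover have "bracket r (v - a *s x1 - b *s x2 - c *s x3) = 0"
      using bracket_eq_form_centralizer13(1)[OF m r] rad[OF m] by simp
    ultimately show ?thesis
      by (simp add: bracket_diff_right bracket_scale_right bracket_centralizer13[OF r])
  qed
  then show ?thesis
    using center_span by (auto simp: center_def)
qed

text \<open>The radical of the form on the centralizer consists of the multiples of \<open>z\<close> if \<open>x\<^sub>2\<close> is
  orthogonal to it, and this gives the even table.  Otherwise it contains some \<open>z\<^sub>1\<close> with
  \<open>[x\<^sub>2, z\<^sub>1] = z\<close>; subtracting multiples of \<open>z\<^sub>1\<close> makes all of the radical orthogonal to \<open>x\<^sub>2\<close>,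
  so it is spanned by \<open>z\<^sub>1\<close> and \<open>z\<close>, and this gives the odd table.\<close>

lemma normal_form_of_orthogonal_splitting:
  assumes pq: "p ` {..<k} \<subseteq> centralizer13" "q ` {..<k} \<subseteq> centralizer13"
    and hyp: "\<omega>.hyperbolic k p q"
    and split: "\<And>w. w \<in> centralizer13 \<Longrightarrow>
      \<exists>c\<in>span (p ` {..<k} \<union> q ` {..<k}). \<forall>u\<in>centralizer13. form (w - c) u = 0"
    and orth: "\<And>i. i < k \<Longrightarrow> form x2 (p i) = 0" "\<And>i. i < k \<Longrightarrow> form x2 (q i) = 0"
  shows "\<exists>m e. span (e ` basis_indices m) = UNIV \<and> e Z \<noteq> 0 \<and>
    nonzero_products (basis_indices m) e (product_table m)"
proof -
  let ?M = centralizer13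
  \<comment> \<open>The hyperbolic pairs interleaved: \<open>p j\<close> and \<open>q j\<close> stand at the positions \<open>2 j + 1\<close>
      and \<open>2 j + 2\<close>, since the indices of the \<open>z\<^sub>i\<close> start at \<open>1\<close>.\<close>
  define h where "h i = (if odd i then p (i div 2) else q (i div 2 - 1))" for i :: nat
  have h_hyp: "h i \<in> ?M" "form x2 (h i) = 0" if "1 \<le> i" "i \<le> 2 * k" for i
    using pq orth that by (auto simp: h_def elim!: evenE oddE)
  have h_form: "form (h i) (h j) =
      (if odd i \<and> j = i + 1 then 1 else if odd j \<and> i = j + 1 then -1 else 0)"
    if "1 \<le> i" "i \<le> 2 * k" "1 \<le> j" "j \<le> 2 * k" for i j
  proof -
    have fp: "form (p a) (p b) = 0" "form (q a) (q b) = 0"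
      "form (p a) (q b) = (if a = b then 1 else 0)" "form (q a) (p b) = (if a = b then - 1 else 0)"
      if "a < k" "b < k" for a b
      using hyp that \<omega>.form_skew[of "q a" "p b"] by (auto simp: \<omega>.hyperbolic_def)
    show ?thesis
      using that by (auto simp: h_def fp elim!: evenE oddE)
  qed
  have h_bracket: "bracket x2 (h i) = 0" "bracket (h i) x2 = 0" "bracket x1 (h i) = 0"
    "bracket (h i) x1 = 0" "bracket x3 (h i) = 0" "bracket (h i) x3 = 0"
    if "1 \<le> i" "i \<le> 2 * k" for i
    using bracket_eq_form_centralizer13(2)[OF h_hyp(1)[OF that]] h_hyp[OF that]
      bracket_centralizer13[OF h_hyp(1)[OF that]] bracket_skew[of "h i" x2] by auto
  have h_h: "bracket (h i) (h j) =
      (if odd i \<and> j = i + 1 then z else if odd j \<and> i = j + 1 then - z else 0)"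
    if "1 \<le> i" "i \<le> 2 * k" "1 \<le> j" "j \<le> 2 * k" for i j
    using bracket_eq_form_centralizer13(1)[of "h j" "h i"] h_hyp(1) h_form[OF that] that
    by auto
  have h_image: "p ` {..<k} \<union> q ` {..<k} \<subseteq> h ` {1..2 * k}"
  proof -
    have "p i \<in> h ` {1..2 * k}" if "i < k" for i
      using that by (intro image_eqI[of _ _ "2 * i + 1"]) (auto simp: h_def)
    moreover have "q i \<in> h ` {1..2 * k}" if "i < k" for i
      using that by (intro image_eqI[of _ _ "2 * i + 2"]) (auto simp: h_def)
    ultimately show ?thesis
      by blast
  qed
  have x_bracket: "bracket x2 x1 = - x3" "bracket x3 x1 = - z" "bracket x3 x2 = 0"
    using bracket_skew[of x2 x1] bracket_skew[of x3 x1] bracket_skew[of x3 x2]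
    by (simp_all add: bracket_12 bracket_13 bracket_23)
  note brackets = h_bracket h_h x_bracket bracket_12 bracket_13 bracket_23 bracket_self
  \<comment> \<open>A family spans as soon as it contains the frame and the hyperbolic vectors and its span
      contains the radical.\<close>
  have spanning: "span S = UNIV" if S: "{x1, x2, x3} \<subseteq> S" "h ` {1..2 * k} \<subseteq> S"
    and rad: "\<And>r. r \<in> ?M \<Longrightarrow> (\<And>u. u \<in> ?M \<Longrightarrow> form r u = 0) \<Longrightarrow> r \<in> span S" for S
  proof -
    have "v \<in> span S" for v
    proof -
      obtain a b c where m: "v - a *s x1 - b *s x2 - c *s x3 \<in> ?M" (is "?m \<in> _")
        using frame_decomposition by blast
      obtain y where y: "y \<in> span (p ` {..<k} \<union> q ` {..<k})" "\<forall>u\<in>?M. form (?m - y) u = 0"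
        using split[OF m] by blast
      have "y \<in> ?M"
        using y(1) span_minimal[OF _ subspace_centralizer13, of "p ` {..<k} \<union> q ` {..<k}"] pq
        by auto
      then have "?m - y \<in> span S"
        using rad[of "?m - y"] y(2) m by (auto intro: subspace_diff[OF subspace_centralizer13])
      moreover have "y \<in> span S"
        using y(1) h_image S(2) span_mono[of "p ` {..<k} \<union> q ` {..<k}" S] by blast
      ultimately have "(?m - y) + y + a *s x1 + b *s x2 + c *s x3 \<in> span S"
        using S(1) by (intro span_add span_scale) (auto intro: span_base)
      then show ?thesis
        by simp
    qed
    then show ?thesis
      by blast
  qed
  show ?thesis
  proof (cases "\<forall>r\<in>?M. (\<forall>u\<in>?M. form r u = 0) \<longrightarrow> form x2 r = 0")
    case True
    define e where "e i = (case i of X1 \<Rightarrow> x1 | X2 \<Rightarrow> x2 | X3 \<Rightarrow> x3 | Z \<Rightarrow> z | Zs a \<Rightarrow> h a)" for i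
    let ?I = "basis_indices (2 * k)"
    have e: "e X1 = x1" "e X2 = x2" "e X3 = x3" "e Z = z" "e (Zs a) = h a" for a
      by (simp_all add: e_def)
    have img: "e ` ?I = {x1, x2, x3, z} \<union> h ` {1..2 * k}"
      by (auto simp: basis_indices_def e image_image)
    have "span (e ` ?I) = UNIV"
    proof (rule spanning)
      show "r \<in> span (e ` ?I)" if "r \<in> ?M" "\<And>u. u \<in> ?M \<Longrightarrow> form r u = 0" for r
        using radical_in_center[of r] True that span_mono[of "{z}" "e ` ?I"] by (auto simp: img)
    qed (auto simp: img)
    moreover have "nonzero_products ?I e (product_table (2 * k))"
      unfolding nonzero_products_def
    proof (intro conjI ballI impI; (clarify)?)
      show "bracket (e i) (e j) = e l" if "(i, j, l) \<in> product_table (2 * k)" for i j l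
        using that by (auto simp: product_table_even e brackets Suc_le_eq odd_pos)
      show "bracket (e i) (e j) = 0" if "i \<in> ?I" "j \<in> ?I"
        "\<forall>l. (i, j, l) \<notin> product_table (2 * k) \<and> (j, i, l) \<notin> product_table (2 * k)" for i j
        using that by (auto simp: basis_indices_def product_table_even e brackets)
    qed
    ultimately show ?thesis
      using z_nonzero e(4) by (intro exI[of _ "2 * k"] exI[of _ e]) auto
  next
    case False
    then obtain r0 where r0: "r0 \<in> ?M" "\<And>u. u \<in> ?M \<Longrightarrow> form r0 u = 0" "form x2 r0 \<noteq> 0"
      by blast
    define z1 where "z1 = inverse (form x2 r0) *s r0"
    have z1: "z1 \<in> ?M" "\<And>u. u \<in> ?M \<Longrightarrow> form z1 u = 0" "form x2 z1 = 1"
      using r0 by (auto simp: z1_def \<omega>.form_scale_left \<omega>.form_scale_right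
          intro: subspace_scale[OF subspace_centralizer13])
    have z1_h: "bracket z1 (h i) = 0" "bracket (h i) z1 = 0" if "1 \<le> i" "i \<le> 2 * k" for i
      using bracket_eq_form_centralizer13(1)[OF h_hyp(1)[OF that] z1(1)] z1(2)[OF h_hyp(1)[OF that]]
        bracket_skew[of "h i" z1] by auto
    have z1_x: "bracket x2 z1 = z" "bracket z1 x2 = - z"
      using bracket_eq_form_centralizer13(2)[OF z1(1)] z1(3) bracket_skew[of z1 x2] by auto
    note brackets' = brackets z1_h z1_x bracket_centralizer13[OF z1(1)]
    \<comment> \<open>The vector \<open>z\<^sub>1\<close> comes first and moves the hyperbolic pairs up by one position.\<close>
    define e where "e i = (case i of X1 \<Rightarrow> x1 | X2 \<Rightarrow> x2 | X3 \<Rightarrow> x3 | Z \<Rightarrow> z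
      | Zs a \<Rightarrow> if a = 1 then z1 else h (a - 1))" for i
    let ?n = "2 * k + 1"
    let ?I = "basis_indices ?n"
    have e: "e X1 = x1" "e X2 = x2" "e X3 = x3" "e Z = z"
      "e (Zs a) = (if a = 1 then z1 else h (a - 1))" for a
      by (simp_all add: e_def)
    have img: "{x1, x2, x3, z, z1} \<union> h ` {1..2 * k} \<subseteq> e ` ?I"
    proof -
      have "e i \<in> e ` ?I" if "i \<in> {X1, X2, X3, Z, Zs 1}" for i
        using that by (intro imageI) (auto simp: basis_indices_def)
      then have "{x1, x2, x3, z, z1} \<subseteq> e ` ?I"
        using e by (metis (no_types, lifting) empty_subsetI insertCI insert_subset)
      moreover have "h i \<in> e ` ?I" if "i \<in> {1..2 * k}" for i
        using that by (intro image_eqI[of _ _ "Zs (i + 1)"]) (auto simp: e basis_indices_def)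
      ultimately show ?thesis
        by blast
    qed
    have "span (e ` ?I) = UNIV"
    proof (rule spanning)
      show "r \<in> span (e ` ?I)" if r: "r \<in> ?M" "\<And>u. u \<in> ?M \<Longrightarrow> form r u = 0" for r
      proof -
        let ?r = "r - form x2 r *s z1"
        have "?r \<in> span {z}"
        proof (rule radical_in_center)
          show "?r \<in> ?M"
            using r z1 by (intro subspace_diff[OF subspace_centralizer13]
                subspace_scale[OF subspace_centralizer13])
        qed (simp_all add: r z1 \<omega>.form_diff_left \<omega>.form_diff_right \<omega>.form_scale_left \<omega>.form_scale_right)
        then have "r \<in> span {z1, z}"
          by (auto simp: span_insert)
        then show ?thesis
          using span_mono[of "{z1, z}" "e ` ?I"] img by auto
      qed
    qed (use img in auto)
    moreover have "nonzero_products ?I e (product_table ?n)"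
      unfolding nonzero_products_def
    proof (intro conjI ballI impI; (clarify)?)
      show "bracket (e i) (e j) = e l" if "(i, j, l) \<in> product_table ?n" for i j l
        using that by (auto simp: product_table_odd e brackets')
      show "bracket (e i) (e j) = 0" if "i \<in> ?I" "j \<in> ?I"
        "\<forall>l. (i, j, l) \<notin> product_table ?n \<and> (j, i, l) \<notin> product_table ?n" for i j
        using that by (auto simp: basis_indices_def product_table_odd e brackets')
    qed
    ultimately show ?thesis
      using z_nonzero e(4) by (intro exI[of _ ?n] exI[of _ e]) auto
  qed
qed

theorem normal_form_exists:
  assumes "dim UNIV > 0"
  shows "\<exists>m e. span (e ` basis_indices m) = UNIV \<and> e Z \<noteq> 0 \<and>
    nonzero_products (basis_indices m) e (product_table m)"
proof -
  obtain Bs where Bs: "Bs \<subseteq> UNIV" "independent Bs" "UNIV \<subseteq> span Bs" "card Bs = dim UNIV"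
    by (rule basis_exists)
  have "finite Bs"
    by (rule card_ge_0_finite) (use assms in \<open>simp only: Bs(4)\<close>)
  obtain A where A: "A \<subseteq> centralizer13" "independent A" "centralizer13 \<subseteq> span A"
    "card A = dim centralizer13"
    by (rule basis_exists)
  have "finite A"
    using independent_span_bound[OF \<open>finite Bs\<close> A(2)] Bs(3) by blast
  have M: "span A = centralizer13"
    using A(3) span_minimal[OF A(1) subspace_centralizer13] by (rule subset_antisym[rotated])
  obtain k p q where pq: "p ` {..<k} \<subseteq> centralizer13" "q ` {..<k} \<subseteq> centralizer13"
    "\<omega>.hyperbolic k p q"
    "\<And>w. w \<in> centralizer13 \<Longrightarrow>
      \<exists>c\<in>span (p ` {..<k} \<union> q ` {..<k}). \<forall>u\<in>centralizer13. form (w - c) u = 0"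
    by (rule \<omega>.hyperbolic_splitting[OF \<open>finite A\<close>, unfolded M]) (rule that)
  obtain c where c: "c \<in> span (p ` {..<k} \<union> q ` {..<k})"
    "\<And>i. i < k \<Longrightarrow> form (x2 - c) (p i) = 0" "\<And>i. i < k \<Longrightarrow> form (x2 - c) (q i) = 0"
    by (rule \<omega>.hyperbolic_projection[OF pq(3), where v = x2]) (rule that)
  have "c \<in> centralizer13"
    using c(1) pq(1,2) span_minimal[OF _ subspace_centralizer13, of "p ` {..<k} \<union> q ` {..<k}"]
    by auto
  then interpret shifted: filiform_frame scale bracket x1 "x2 - c" x3 z
    by (rule frame_shift)
  show ?thesis
    using shifted.normal_form_of_orthogonal_splitting[OF pq c(2,3)] .
qed

end

theorem theorem4p5:
  fixes scale :: "'f::field \<Rightarrow> 'a::ab_group_add \<Rightarrow> 'a"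
    and bracket :: "'a \<Rightarrow> 'a \<Rightarrow> 'a"
    and n :: nat
  assumes char: "CHAR('f) \<noteq> 2"
    and n: "n \<ge> 1"
    and lie: "lie_algebra scale bracket"
    and pure: "lie_algebra.pure scale bracket"
    and nilpotent: "lie_algebra.nilpotent scale bracket"
    and dim: "vector_space.dim scale (UNIV :: 'a set) = n + 4"
    and breadth: "lie_algebra.breadth scale bracket = 2"
    and dim_derived: "vector_space.dim scale (lie_algebra.derived scale bracket) = 2"
    and dim_center: "vector_space.dim scale (lie_algebra.center bracket) = 1"
  shows "\<exists>e :: basis_index \<Rightarrow> 'a.
    lie_algebra.basis_family scale (basis_indices n) e \<and>
    (even n \<longrightarrow> lie_algebra.nonzero_products bracket (basis_indices n) e
       ({(X1, X2, X3), (X1, X3, Z)} \<union>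
        {(Zs i, Zs (i + 1), Z) | i. odd i \<and> i + 1 \<le> n})) \<and>
    (odd n \<longrightarrow> lie_algebra.nonzero_products bracket (basis_indices n) e
       ({(X1, X2, X3), (X1, X3, Z), (X2, Zs 1, Z)} \<union>
        {(Zs (i + 1), Zs (i + 2), Z) | i. odd i \<and> i + 2 \<le> n}))"
proof -
  interpret lie_algebra scale bracket
    by (rule lie)
  have fin: "dim UNIV > 0"
    using dim by simp
  obtain x1 x2 x3 z where "bracket x1 x2 = x3" "bracket x1 x3 = z" "bracket x2 x3 = 0"
    "z \<noteq> 0" "center = span {z}" "\<And>u v. \<exists>b c. bracket u v = scale b x3 + scale c z"
    using filiform_frame_exists[OF nilpotent fin dim_derived dim_center] by metis
  then interpret filiform_frame scale bracket x1 x2 x3 z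
    by unfold_locales
  obtain m e where e: "span (e ` basis_indices m) = UNIV" "e Z \<noteq> 0"
    "nonzero_products (basis_indices m) e (product_table m)"
    using normal_form_exists[OF fin] by blast
  have ind: "inj_on e (basis_indices m)" "independent (e ` basis_indices m)"
    using product_table_independent[OF e(3,2)] by auto
  have "m + 4 = card (e ` basis_indices m)"
    by (simp add: card_image[OF ind(1)] card_basis_indices)
  also have "\<dots> = n + 4"
    using dim_eq_card[of "e ` basis_indices m" UNIV] ind(2) e(1) dim by simp
  finally have "m = n"
    by simp
  then have "basis_family (basis_indices n) e"
    using ind e(1) by (simp add: basis_family_def)
  moreover have "nonzero_products (basis_indices n) e (product_table n)"
    using e(3) \<open>m = n\<close> by simp
  ultimately show ?thesis
    unfolding product_table_def by (intro exI[of _ e]) auto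
qed

end
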